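(* Let $t_1,t_2,t_3$, $h'_i,l'_i$ ($i=1,2,3$), $\alpha',\beta',\mu_0,\alpha$ be complex parameters, and let $\xi\neq0$ be either independent of $x$ or of the form $\xi=Ax$ with $A$ independent of $x$. Assume that the function $h(s)$ satisfies $$A^{\langle 3 \rangle} \big( s; h'_1, h'_2, h'_3, l'_1, l'_2, l'_3, \alpha ', \beta ' \big) h(s) = E' h(s)$$ and $$\lim _{L \to +\infty } \frac{h(s)}{s^{(h'_1 + h'_2 + h'_3 - l'_1 - l'_2 - l'_3 - 2 \alpha ' + \beta ' +2)/2}} \Big| _{s=q^{L} \xi } = 0, \qquad \lim _{K \to -\infty } \frac{h(s)}{s^{-\alpha ' -1}} \Big| _{s=q^{K} \xi } = 0$$ for some constant $E'$. Set \begin{gather*} \chi = \big( l'_1 + l'_2 + l'_3 - h'_1 - h'_2 - h'_3 - \beta ' \big)/2 , \qquad E = q^{2 \mu _0 + \alpha - \alpha ' + \chi} E', \qquad \mu = \mu _0 +1+ \chi, \\ \beta = -\beta ' - \chi , \qquad l_i = l'_i +\mu _0 , \qquad h_i = h'_i +\mu _0 +\chi ,\qquad i=1,2,3. \end{gather*} Then the Jackson integral $$g (x) = x^{- \alpha } \int^{\xi \infty }_{0} s^{-(h'_1 + h'_2 + h'_3 - l'_1 - l'_2 - l'_3 - 2 \alpha ' + \beta ' +2)/2} h(s) P^{(1)}_{\mu ,\mu _0 } (x,s)\, {\rm d}_{q}s$$ converges and it satisfies $$A^{\langle 3 \rangle} ( x; h_1, h_2, h_3, l_1, l_2, l_3,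 \alpha , \beta ) g (x) = E g(x) .$$
   Context: $q$ is a complex number with $0<|q|<1$. Complex powers are taken with a fixed branch of $\log q$, so that $q^a=\exp(a\log q)$ and power functions obey $(q^{\pm1}x)^a=q^{\pm a}x^a$. Formulas are understood at points where all expressions are defined. Notation: $(a;q)_\infty=\prod_{j=0}^\infty(1-q^ja)$ and $$P^{(1)}_{\mu ,\mu _0 } (x,s)= \frac{(q^{\mu }s/x;q)_{\infty }}{(q^{\mu _0 }s/x;q)_{\infty }}.$$ The Jackson integral is the bilateral series $$\int^{\xi \infty }_{0}f(s)\, {\rm d}_{q}s = (1-q)\sum^{\infty}_{n=-\infty}q^{n} \xi f(q^n \xi ).$$ If $\xi=Ax$, replacing $x$ by $q^{\pm1}x$ in $g(x)$ also replaces $\xi$ by $q^{\pm1}\xi$. $T_x^{\pm1}$ is the $q$-shift operator, $T_x^{\pm1}g(x)=g(q^{\pm1}x)$. With fixed complex parameters $t_1,t_2,t_3$ (the same in all operators), \begin{gather*} A^{\langle 3 \rangle} ( x; h_1, h_2, h_3, l_1, l_2, l_3, \alpha , \beta ) = x^{-1} \prod_{n=1}^3 (x- q^{h_n+1/2} t_n) T_{x}^{-1} + q^{2\alpha +1} x^{-1} \prod_{n=1}^3 (x- q^{l_n -1/2} t_n ) T_x \\ {} + q^{\alpha +1/2} \Big[ -(q^{1/2} +q^{-1/2} ) x^2 +\sum _{n=1}^3 ( q^{h_n} + q^{l_n} )t_n x + q^{(l_1 +l_2 +l_3 +h_1 +h_2 +h_3)/2} ( q^{\beta/2} + q^{-\beta/2}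 ) t_1 t_2 t_3 x^{-1} \Big], \end{gather*} and $A^{\langle 3 \rangle}(s;\dots)$ is the same operator in the variable $s$. *)

theory Defs
  imports "HOL-Analysis.Analysis"
begin

text \<open>
  Powers are taken relative to a fixed logarithm \<open>lq\<close> of \<open>q\<close> and a fixed choice \<open>Lg\<close> of
  logarithms on the punctured plane. The last clause is what makes the power functions
  satisfy \<open>(q x)\<^sup>a = q\<^sup>a x\<^sup>a\<close>; the principal branch \<open>Ln\<close> does not satisfy it, so
  \<open>powr\<close> cannot be used. No continuity of \<open>Lg\<close> is required: only values on \<open>q\<close>-lattices
  are ever compared.
\<close>

definition log_branch :: "complex \<Rightarrow> complex \<Rightarrow> (complex \<Rightarrow> complex) \<Rightarrow> bool" where
  "log_branch q lq Lg \<longleftrightarrow>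
     exp lq = q \<and> (\<forall>x. x \<noteq> 0 \<longrightarrow> exp (Lg x) = x \<and> Lg (q * x) = lq + Lg x)"

definition qpow :: "complex \<Rightarrow> complex \<Rightarrow> complex" where
  "qpow lq a = exp (a * lq)"

definition xpow :: "(complex \<Rightarrow> complex) \<Rightarrow> complex \<Rightarrow> complex \<Rightarrow> complex" where
  "xpow Lg x a = exp (a * Lg x)"

definition qpoch_inf :: "complex \<Rightarrow> complex \<Rightarrow> complex" where
  "qpoch_inf a q = prodinf (\<lambda>j. 1 - q ^ j * a)"

definition kernel_P ::
  "complex \<Rightarrow> complex \<Rightarrow> complex \<Rightarrow> complex \<Rightarrow> complex \<Rightarrow> complex \<Rightarrow> complex" where
  "kernel_P q lq \<mu> \<mu>0 x s =
     qpoch_inf (qpow lq \<mu> * s / x) q / qpoch_inf (qpow lq \<mu>0 * s / x) q"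

text \<open>
  \<open>infsum\<close> has the junk value 0 for families that are not summable, so the value of
  \<open>jackson_integral\<close> is meaningful only together with \<open>jackson_converges\<close>. Summability of
  the family over \<open>int\<close> amounts to absolute convergence of the bilateral series.
\<close>

definition jackson_converges :: "complex \<Rightarrow> complex \<Rightarrow> (complex \<Rightarrow> complex) \<Rightarrow> bool" where
  "jackson_converges q \<xi> f \<longleftrightarrow> (\<lambda>n::int. q powi n * \<xi> * f (q powi n * \<xi>)) summable_on UNIV"

definition jackson_integral :: "complex \<Rightarrow> complex \<Rightarrow> (complex \<Rightarrow> complex) \<Rightarrow> complex" where
  "jackson_integral q \<xi> f = (1 - q) * (\<Sum>\<^sub>\<infinity>n::int. q powi n * \<xi> * f (q powi n * \<xi>))"

text \<open>
  The operator \<open>A\<^sup>\<langle>\<^sup>3\<^sup>\<rangle>\<close> applied to a function \<open>f\<close> and evaluated at \<open>x\<close>. The families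
  \<open>t\<close>, \<open>h\<close>, \<open>l\<close> are used at the indices 1, 2, 3 only.
\<close>

definition A3 ::
  "complex \<Rightarrow> complex \<Rightarrow> (nat \<Rightarrow> complex) \<Rightarrow> (nat \<Rightarrow> complex) \<Rightarrow> (nat \<Rightarrow> complex) \<Rightarrow>
   complex \<Rightarrow> complex \<Rightarrow> (complex \<Rightarrow> complex) \<Rightarrow> complex \<Rightarrow> complex" where
  "A3 q lq t h l \<alpha> \<beta> f x =
     inverse x * (\<Prod>n=1..3. x - qpow lq (h n + 1/2) * t n) * f (inverse q * x)
   + qpow lq (2 * \<alpha> + 1) * inverse x * (\<Prod>n=1..3. x - qpow lq (l n - 1/2) * t n) * f (q * x)
   + qpow lq (\<alpha> + 1/2) *
       (- (qpow lq (1/2) + qpow lq (- 1/2)) * x\<^sup>2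
        + (\<Sum>n=1..3. (qpow lq (h n) + qpow lq (l n)) * t n) * x
        + qpow lq ((l 1 + l 2 + l 3 + h 1 + h 2 + h 3) / 2)
            * (qpow lq (\<beta> / 2) + qpow lq (- \<beta> / 2)) * t 1 * t 2 * t 3 * inverse x)
       * f x"

text \<open>Suitable choices of logarithms exist.\<close>

lemma log_branch_exists:
  assumes "q \<noteq> 0" "norm q < 1" "exp lq = q"
  shows "\<exists>Lg. log_branch q lq Lg"
proof -
  define k where "k x = \<lfloor>ln (norm x) / ln (norm q)\<rfloor>" for x :: complex
  define Lg where "Lg x = of_int (k x) * lq + Ln (x / q powi k x)" for x
  have lnq: "ln (norm q) \<noteq> 0" using assms by simp
  have ex: "exp (of_int m * lq) = q powi m" for m :: int
    using assms(3) by (metis exp_power_int mult.commute)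
  have "exp (Lg x) = x" if "x \<noteq> 0" for x
    using that assms(1) by (simp add: Lg_def exp_add ex)
  moreover have "Lg (q * x) = lq + Lg x" if "x \<noteq> 0" for x
  proof -
    have "ln (norm (q * x)) / ln (norm q) = ln (norm x) / ln (norm q) + 1"
      using that assms(1) lnq by (simp add: norm_mult ln_mult field_simps)
    hence "k (q * x) = k x + 1" by (simp add: k_def)
    thus ?thesis using assms(1) by (simp add: Lg_def power_int_add algebra_simps)
  qed
  ultimately show ?thesis using assms(3) by (auto simp: log_branch_def)
qed

end

theory Submission
  imports Defs
begin

text \<open>
  The kernel \<open>P(x, s)\<close> is a function of \<open>s/x\<close>, so a \<open>q\<close>-shift of \<open>x\<close> is the inverse \<open>q\<close>-shift of \<open>s\<close>.
  Applying the operator in \<open>x\<close> to the integral therefore produces, under the integral sign, a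
  three-term expression in the kernel along the lattice \<open>q\<^sup>\<int> \<xi>\<close>. The parameters are related in such
  a way that this expression is, up to the factor \<open>q\<^bsup>2\<mu>\<^sub>0 + \<alpha> - \<alpha>' + \<chi>\<^esup>\<close>, the formal adjoint in \<open>s\<close> of
  the given operator acting on the kernel (lemma \<open>kernel_identity\<close>). Summation by parts moves the
  adjoint operator onto the eigenfunction, where it becomes multiplication by \<open>E'\<close>; the factor turns
  \<open>E'\<close> into \<open>E\<close>.

  Two analytic points remain. The integral must converge, and the boundary terms of the summation by
  parts must vanish (lemma \<open>summation_by_parts\<close>). Towards the origin the kernel tends to 1, and the first
  growth condition makes the summand \<open>o(q\<^sup>n)\<close>. Towards infinity the kernel behaves like
  \<open>s\<^bsup>\<mu>\<^sub>0 - \<mu>\<^esup> = s\<^bsup>- 1 - \<chi>\<^esup>\<close> (lemma \<open>kernel_P_at_infinity\<close>, from the inversion formula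
  \<open>qpoch_inf_inversion\<close>), and the second growth condition makes the summand \<open>o(s\<^sup>-\<^sup>2)\<close>. This gives absolute
  convergence. After multiplication by the coefficients of the operator, which are \<open>O(1/s)\<close> at the
  origin and \<open>O(s\<^sup>2)\<close> at infinity, the same estimates give only \<open>o(1)\<close>: too little to sum the
  separate pieces absolutely, but enough for the telescoping boundary terms. For this reason the
  summation by parts is carried out termwise and not by shifting separate series.

  The base point \<open>\<xi>\<close> matters only through its lattice (lemma \<open>jackson_shift\<close>), so the cases of a
  constant \<open>\<xi>\<close> and of \<open>\<xi> = A x\<close> coincide.
\<close>

section \<open>Infinite q-products\<close>

lemma qpoch_inf_convergent:
  fixes q a :: complex
  assumes "norm q < 1"
  shows "convergent_prod (\<lambda>j. 1 - q ^ j * a)"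
proof -
  have "summable (\<lambda>j. norm (q ^ j * a))"
    using assms by (simp add: norm_mult norm_power summable_mult2 summable_geometric)
  hence "abs_convergent_prod (\<lambda>j. 1 + - (q ^ j * a))"
    by (intro summable_imp_abs_convergent_prod) simp
  thus ?thesis by (simp add: abs_convergent_prod_imp_convergent_prod)
qed

lemma qpoch_inf_split:
  assumes "norm q < 1"
  shows "qpoch_inf a q = (\<Prod>j<n. 1 - q ^ j * a) * qpoch_inf (q ^ n * a) q"
  using has_prod_unique [OF has_prod_ignore_initial_segment'
          [OF qpoch_inf_convergent [OF assms, of a], of n]]
  by (simp add: qpoch_inf_def power_add mult_ac)

lemma qpoch_inf_step:
  assumes "norm q < 1"
  shows "qpoch_inf a q = (1 - a) * qpoch_inf (q * a) q"
  using qpoch_inf_split [OF assms, of a 1] by simp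

lemma qpoch_inf_partial_products:
  assumes "norm q < 1"
  shows "(\<lambda>n. \<Prod>j<n. 1 - q ^ j * a) \<longlonglongrightarrow> qpoch_inf a q"
  using convergent_prod_LIMSEQ [OF qpoch_inf_convergent [OF assms, of a]]
  unfolding qpoch_inf_def by (subst LIMSEQ_lessThan_iff_atMost)

lemma qpoch_inf_nonzero:
  assumes "norm q < 1" "\<And>j. q ^ j * a \<noteq> 1"
  shows "qpoch_inf a q \<noteq> 0"
  unfolding qpoch_inf_def
  by (rule prodinf_nonzero [OF qpoch_inf_convergent [OF assms(1)]])
     (use assms(2) in \<open>metis eq_iff_diff_eq_0\<close>)

text \<open>
  Once \<open>\<bar>q\<^sup>N a\<bar> < 1\<close> no factor vanishes any more, and the tail of the product is the full
  product divided by a partial product, which tends to 1 because the product converges to a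
  nonzero value. Passing to \<open>q\<^sup>N a\<close> first avoids the points \<open>a\<close> where the full product is zero.
\<close>

lemma qpoch_inf_tendsto_1:
  assumes "norm q < 1"
  shows "(\<lambda>n. qpoch_inf (q ^ n * a) q) \<longlonglongrightarrow> 1"
proof -
  have "(\<lambda>n. q ^ n * a) \<longlonglongrightarrow> 0"
    using tendsto_mult_left_zero [OF LIMSEQ_power_zero [OF assms]] .
  hence "\<forall>\<^sub>F n in sequentially. norm (q ^ n * a) < 1"
    using order_tendstoD(2)[OF tendsto_norm_zero] zero_less_one by blast
  then obtain N where N: "\<And>n. n \<ge> N \<Longrightarrow> norm (q ^ n * a) < 1"
    by (auto simp: eventually_sequentially)
  define b where "b = q ^ N * a"
  have b: "q ^ j * b \<noteq> 1" for j
    using N[of "j + N"] by (auto simp: b_def power_add mult_ac)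
  define P where "P n = (\<Prod>j<n. 1 - q ^ j * b)" for n
  have P0: "P n \<noteq> 0" for n using b by (auto simp: P_def)
  have nz: "qpoch_inf b q \<noteq> 0" by (rule qpoch_inf_nonzero [OF assms b])
  have "(\<lambda>n. qpoch_inf b q / P n) \<longlonglongrightarrow> qpoch_inf b q / qpoch_inf b q"
    unfolding P_def by (intro tendsto_intros qpoch_inf_partial_products assms nz)
  moreover have "qpoch_inf b q / P n = qpoch_inf (q ^ (n + N) * a) q" for n
    using qpoch_inf_split [OF assms, of b n] P0[of n]
    by (simp add: P_def b_def power_add mult_ac)
  ultimately have "(\<lambda>n. qpoch_inf (q ^ (n + N) * a) q) \<longlonglongrightarrow> 1"
    using nz by simp
  thus ?thesis by (rule LIMSEQ_offset)
qed

text \<open>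
  The factors \<open>1 - a / q\<^sup>i\<close> gained by moving away from the origin grow without bound; writing
  each as \<open>- a / q\<^sup>i\<close> times \<open>1 - q\<^sup>i / a\<close> leaves explicit monomials and a convergent product.
  This is the growth law of the theta function \<open>(a; q)\<^sub>\<infinity> (q/a; q)\<^sub>\<infinity>\<close>.
\<close>

lemma qpoch_inf_inversion:
  assumes "norm q < 1" "q \<noteq> 0" "a \<noteq> 0"
  shows "qpoch_inf (a / q ^ n) q =
           (\<Prod>i<n. - a / q ^ Suc i) * (\<Prod>j<n. 1 - q ^ j * (q / a)) * qpoch_inf a q"
proof (induction n)
  case (Suc n)
  define c where "c = q ^ n"
  have c: "c \<noteq> 0" "q ^ Suc n = q * c" using assms(2) by (simp_all add: c_def)
  have "qpoch_inf (a / (q * c)) q = (1 - a / (q * c)) * qpoch_inf (q * (a / (q * c))) q"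
    by (rule qpoch_inf_step [OF assms(1)])
  also have "q * (a / (q * c)) = a / c" using assms(2) by simp
  also have "1 - a / (q * c) = - a / (q * c) * (1 - c * (q / a))"
    using assms c(1) by (simp add: right_diff_distrib)
  also have "qpoch_inf (a / c) q = 
      (\<Prod>i<n. - a / q ^ Suc i) * (\<Prod>j<n. 1 - q ^ j * (q / a)) * qpoch_inf a q"
    using Suc.IH unfolding c_def .
  finally show ?case
    unfolding prod.lessThan_Suc c(2) c_def[symmetric] by (simp only: mult_ac)
qed simp

text \<open>
  In a quotient the super-exponential monomials \<open>q\<^bsup>-n(n+1)/2\<^esup>\<close> of the two products cancel, and
  only the geometric factor \<open>(a/b)\<^sup>n\<close> survives. The limit may be zero, which happens when the
  numerator vanishes for all large \<open>n\<close>.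
\<close>

lemma qpoch_inf_ratio_asymp:
  assumes "norm q < 1" "q \<noteq> 0" "a \<noteq> 0" "b \<noteq> 0"
    and nz: "\<And>n. qpoch_inf (b / q ^ n) q \<noteq> 0"
  shows "(\<lambda>n. qpoch_inf (a / q ^ n) q / qpoch_inf (b / q ^ n) q * (b / a) ^ n) \<longlonglongrightarrow>
           qpoch_inf (q / a) q * qpoch_inf a q / (qpoch_inf (q / b) q * qpoch_inf b q)"
proof -
  define N where "N c n = (\<Prod>j<n. 1 - q ^ j * (q / c))" for c and n :: nat
  have "q ^ j * (q / b) \<noteq> 1" for j
  proof
    assume "q ^ j * (q / b) = 1"
    hence "b / q ^ Suc j = 1" using assms by (auto simp: field_simps)
    thus False using nz[of "Suc j"] qpoch_inf_step [OF assms(1), of 1] by simp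
  qed
  hence nz': "qpoch_inf (q / b) q \<noteq> 0" by (rule qpoch_inf_nonzero [OF assms(1)])
  have lim: "(\<lambda>n. N c n) \<longlonglongrightarrow> qpoch_inf (q / c) q" for c
    unfolding N_def by (rule qpoch_inf_partial_products [OF assms(1)])
  have "qpoch_inf b q \<noteq> 0" using nz[of 0] by simp
  hence "(\<lambda>n. N a n * qpoch_inf a q / (N b n * qpoch_inf b q)) \<longlonglongrightarrow>
           qpoch_inf (q / a) q * qpoch_inf a q / (qpoch_inf (q / b) q * qpoch_inf b q)"
    using nz' by (intro tendsto_intros lim) auto
  moreover have "N a n * qpoch_inf a q / (N b n * qpoch_inf b q) =
      qpoch_inf (a / q ^ n) q / qpoch_inf (b / q ^ n) q * (b / a) ^ n" for n
  proof -
    have "(\<Prod>i<n. - a / q ^ Suc i) = (a / b) ^ n * (\<Prod>i<n. - b / q ^ Suc i)"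
      by (induction n) (use assms in \<open>simp_all add: field_simps\<close>)
    moreover have "(\<Prod>i<n. - b / q ^ Suc i) \<noteq> 0" using assms by auto
    ultimately show ?thesis using assms
      by (simp add: qpoch_inf_inversion [OF assms(1,2)] N_def power_divide)
  qed
  ultimately show ?thesis by simp
qed

section \<open>Bilateral series\<close>

lemma filterlim_at_top_int_iff:
  "filterlim f F at_top \<longleftrightarrow> filterlim (\<lambda>n. f (int n)) F sequentially"
proof
  assume "filterlim f F at_top"
  thus "filterlim (\<lambda>n. f (int n)) F sequentially"
    by (rule filterlim_compose [OF _ filterlim_int_sequentially])
qed (rule filterlim_int_of_nat_at_topD)

lemma filterlim_at_bot_int_iff:
  "filterlim f F at_bot \<longleftrightarrow> filterlim (\<lambda>n. f (- int n)) F sequentially"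
proof -
  have 1: "filterlim (uminus :: int \<Rightarrow> int) at_bot at_top"
    unfolding filterlim_at_bot eventually_at_top_linorder by (metis minus_le_iff)
  have 2: "filterlim (uminus :: int \<Rightarrow> int) at_top at_bot"
    unfolding filterlim_at_top eventually_at_bot_linorder by (metis le_minus_iff)
  have "filterlim f F at_bot \<longleftrightarrow> filterlim (\<lambda>n. f (- n)) F at_top"
    using filterlim_compose [OF _ 1, of f F] filterlim_compose [OF _ 2, of "\<lambda>n. f (- n)" F] by auto
  thus ?thesis by (simp add: filterlim_at_top_int_iff)
qed

lemma filterlim_int_shift:
  "filterlim (\<lambda>n::int. n + k) at_top at_top" "filterlim (\<lambda>n::int. n + k) at_bot at_bot"
proof -
  have "\<exists>N. \<forall>n\<ge>N. Z \<le> n + k" "\<exists>N. \<forall>n\<le>N. n + k \<le> Z" for Z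
    by (rule exI[of _ "Z - k"]; simp)+
  thus "filterlim (\<lambda>n::int. n + k) at_top at_top" "filterlim (\<lambda>n::int. n + k) at_bot at_bot"
    by (simp_all add: filterlim_at_top filterlim_at_bot eventually_at_top_linorder
          eventually_at_bot_linorder)
qed

lemma has_sum_int_split:
  fixes f :: "int \<Rightarrow> complex"
  assumes "((\<lambda>n::nat. f (int n)) has_sum A) UNIV" "((\<lambda>n::nat. f (- int (Suc n))) has_sum B) UNIV"
  shows "(f has_sum (A + B)) UNIV"
proof -
  have U: "UNIV = range int \<union> range (\<lambda>n. - int (Suc n))"
  proof -
    have "x \<in> range int \<union> range (\<lambda>n. - int (Suc n))" for x
      by (cases x rule: int_cases) auto
    thus ?thesis by blast
  qed
  have "(f has_sum A) (range int)"
    using assms(1) by (subst has_sum_reindex) (auto simp: o_def)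
  moreover have "(f has_sum B) (range (\<lambda>n. - int (Suc n)))"
    using assms(2) by (subst has_sum_reindex) (auto simp: o_def inj_on_def)
  ultimately show ?thesis
    unfolding U by (rule has_sum_Un_disjoint) auto
qed

lemma summable_on_nat_geometric:
  fixes f :: "nat \<Rightarrow> complex"
  assumes "norm r < 1" "r \<noteq> 0" "(\<lambda>n. f n / r ^ n) \<longlonglongrightarrow> 0"
  shows "f summable_on UNIV"
proof (rule norm_summable_imp_summable_on, rule summable_comparison_test_ev)
  have "\<forall>\<^sub>F n in sequentially. norm (f n / r ^ n) < 1"
    using order_tendstoD(2)[OF tendsto_norm_zero[OF assms(3)]] by simp
  thus "\<forall>\<^sub>F n in sequentially. norm (norm (f n)) \<le> norm r ^ n"
    by eventually_elim (use assms(2) in \<open>simp add: norm_divide norm_power field_simps\<close>)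
  show "summable (\<lambda>n. norm r ^ n)" using assms(1) by (simp add: summable_geometric)
qed

text \<open>
  The two ratios differ in the application: a Jackson integrand is \<open>o(q\<^sup>n)\<close> towards the origin and
  \<open>o(s\<^sup>-\<^sup>2)\<close> towards infinity.
\<close>

lemma summable_on_int_geometric:
  fixes f :: "int \<Rightarrow> complex"
  assumes r: "norm r < 1" "r \<noteq> 0" "norm r' < 1" "r' \<noteq> 0"
    and top: "((\<lambda>n. f n / r powi n) \<longlongrightarrow> 0) at_top"
    and bot: "((\<lambda>n. f n * r' powi n) \<longlongrightarrow> 0) at_bot"
  shows "f summable_on UNIV"
proof -
  have "(\<lambda>n. f (int n)) summable_on UNIV"
    by (rule summable_on_nat_geometric [OF r(1,2)])
       (use top in \<open>simp add: filterlim_at_top_int_iff\<close>)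
  moreover have "(\<lambda>n. f (- int (Suc n))) summable_on UNIV"
  proof (rule summable_on_nat_geometric [OF r(3,4)])
    have "(\<lambda>n. f (- int n) * r' powi (- int n)) \<longlonglongrightarrow> 0"
      using bot by (simp add: filterlim_at_bot_int_iff)
    hence "(\<lambda>n. r' * (f (- int (Suc n)) * r' powi (- int (Suc n)))) \<longlonglongrightarrow> r' * 0"
      by (intro tendsto_mult tendsto_const LIMSEQ_Suc)
    moreover have "r' * (y * r' powi (- int (Suc n))) = y / r' ^ n" for y n
      using r(4) unfolding power_int_minus power_int_of_nat by (simp add: field_simps)
    ultimately show "(\<lambda>n. f (- int (Suc n)) / r' ^ n) \<longlonglongrightarrow> 0"
      by (simp only: mult_zero_right)
  qed
  ultimately show ?thesis
    using has_sum_int_split unfolding summable_on_def by blast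
qed

text \<open>
  Here \<open>D\<close> will be the boundary term of a summation by parts, which may tend to 0 too slowly to be
  summable. The series of differences is cut at 0, and both halves telescope.
\<close>

lemma infsum_int_telescope:
  fixes f D :: "int \<Rightarrow> complex"
  assumes sm: "f summable_on UNIV" and f: "\<And>n. f n = D (n + 1) - D n"
    and top: "(D \<longlongrightarrow> 0) at_top" and bot: "(D \<longlongrightarrow> 0) at_bot"
  shows "(\<Sum>\<^sub>\<infinity>n. f n) = 0"
proof -
  have "f summable_on range int" "f summable_on range (\<lambda>n. - int (Suc n))"
    using sm summable_on_subset_banach by blast+
  hence "(\<lambda>n. f (int n)) summable_on UNIV" "(\<lambda>n. f (- int (Suc n))) summable_on UNIV"
    by (simp_all add: summable_on_reindex o_def inj_on_def)
  then obtain A B where AB: "((\<lambda>n. f (int n)) has_sum A) UNIV"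
      "((\<lambda>n. f (- int (Suc n))) has_sum B) UNIV"
    unfolding summable_on_def by blast
  have "(\<lambda>n. D (int n)) \<longlonglongrightarrow> 0" "(\<lambda>n. D (- int n)) \<longlonglongrightarrow> 0"
    using top bot by (simp_all add: filterlim_at_top_int_iff filterlim_at_bot_int_iff)
  from telescope_sums [OF this(1)] telescope_sums' [OF this(2)]
  have "(\<lambda>n. D (int (Suc n)) - D (int n)) sums (0 - D (int 0))"
       "(\<lambda>n. D (- int n) - D (- int (Suc n))) sums (D (- int 0) - 0)" .
  hence "(\<lambda>n. f (int n)) sums (- D 0)" "(\<lambda>n. f (- int (Suc n))) sums D 0"
    by (simp_all add: f add.commute)
  hence "A = - D 0" "B = D 0"
    using AB[THEN has_sum_imp_sums] sums_unique2 by blast+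
  thus ?thesis
    using has_sum_int_split [OF AB] by (simp add: infsumI)
qed

text \<open>
  A Jackson integral depends on its base point only through the lattice \<open>q\<^sup>\<int> \<xi>\<close>. Hence a
  base point proportional to \<open>x\<close> behaves under \<open>x \<mapsto> q\<^sup>\<plusminus>\<^sup>1 x\<close> exactly like a constant one.
\<close>

lemma jackson_shift:
  assumes "q \<noteq> 0"
  shows "jackson_integral q (q powi k * \<xi>) f = jackson_integral q \<xi> f"
proof -
  define F where "F n = q powi n * \<xi> * f (q powi n * \<xi>)" for n :: int
  have "(\<Sum>\<^sub>\<infinity>n. q powi n * (q powi k * \<xi>) * f (q powi n * (q powi k * \<xi>)))
          = (\<Sum>\<^sub>\<infinity>n. F (n + k))"
    using assms by (intro infsum_cong) (simp add: F_def power_int_add mult_ac)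
  also have "\<dots> = (\<Sum>\<^sub>\<infinity>n. F n)"
    by (rule infsum_reindex_bij_witness [of _ "\<lambda>n. n - k" "\<lambda>n. n + k"]) auto
  finally show ?thesis
    unfolding jackson_integral_def F_def by (simp only:)
qed

section \<open>The kernel identity\<close>

lemma cubic_quotient_scale:
  fixes k a b c w :: "'a :: field"
  assumes "k \<noteq> 0"
  shows "(k * a) * (k * b) * (k * c) / (k * w) = k\<^sup>2 * (a * b * c / w)"
  using assms by (simp add: power2_eq_square mult_ac)

lemma cubic_quotient_diff:
  fixes x y :: "'a :: field"
  assumes "x \<noteq> 0" "y \<noteq> 0"
  shows "(x - c1) * (x - c2) * (x - c3) / x - (y - c1) * (y - c2) * (y - c3) / y =
         (x - y) * (x + y - (c1 + c2 + c3) + c1 * c2 * c3 / (x * y))"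
  using assms by (simp add: divide_simps) (simp add: algebra_simps)

text \<open>
  The operator in \<open>x\<close> acting on the kernel equals, up to the factor \<open>m\<^sup>2 X\<close>, the formal adjoint of
  the operator in \<open>s\<close> acting on it. Here \<open>Q = q\<^bsup>1/2\<^esup>\<close>, \<open>m = q\<^bsup>\<mu>\<^sub>0\<^esup>\<close>, \<open>X = q\<^bsup>\<chi>\<^esup>\<close>, \<open>H\<^sub>i = q\<^bsup>h'\<^sub>i\<^esup> t\<^sub>i\<close>,
  \<open>L\<^sub>i = q\<^bsup>l'\<^sub>i\<^esup> t\<^sub>i\<close>, and \<open>P\<close>, \<open>Pu\<close>, \<open>Pd\<close> are the kernel at \<open>s\<close>, \<open>q s\<close>, \<open>s/q\<close>. Since the kernel
  depends on \<open>s/x\<close> only, \<open>Pu\<close> and \<open>Pd\<close> are also its values at \<open>x/q\<close> and \<open>q x\<close>, which is what makes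
  the two operators comparable.

  The shifts of the exponents are chosen such that the coefficients of \<open>Pu\<close> on the two sides are the
  values of one function \<open>(z - c\<^sub>1)(z - c\<^sub>2)(z - c\<^sub>3)/z\<close> at \<open>z = x\<close> and at \<open>z = q\<^sup>\<mu> s\<close>. Their
  difference is therefore divisible by \<open>x - q\<^sup>\<mu> s\<close>, the very factor that the recurrence of the kernel
  turns into a multiple of \<open>P\<close>. The same happens for \<open>Pd\<close>. What remains is a rational identity
  multiplying \<open>P\<close>. Stating the two recurrences without denominators keeps the identity valid at
  zeros of the kernel.
\<close>

lemma kernel_identity:
  fixes Q m X x s :: "'a :: field"
  assumes nz: "Q \<noteq> 0" "m \<noteq> 0" "X \<noteq> 0" "x \<noteq> 0" "s \<noteq> 0"
    and up: "(x - m * X * Q\<^sup>2 * s) * Pu = (x - m * s) * P"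
    and dn: "(Q\<^sup>2 * x - m * s) * Pd = Q\<^sup>2 * (x - m * X * s) * P"
  shows "(x - Q * m * X * H1) * (x - Q * m * X * H2) * (x - Q * m * X * H3) / x * Pu
       + Q\<^sup>2 * ((x - m * L1 / Q) * (x - m * L2 / Q) * (x - m * L3 / Q) / x) * Pd
       + Q * (- (Q + 1 / Q) * x\<^sup>2 + (m * X * (H1 + H2 + H3) + m * (L1 + L2 + L3)) * x
              + m ^ 3 * (X\<^sup>2 * (H1 * H2 * H3) + X * (L1 * L2 * L3)) / x) * P
       = m\<^sup>2 * X *
       (X * ((Q\<^sup>2 * s - Q * H1) * (Q\<^sup>2 * s - Q * H2) * (Q\<^sup>2 * s - Q * H3) / (Q\<^sup>2 * s)) * Pu
        + Q\<^sup>2 / X * ((s / Q\<^sup>2 - L1 / Q) * (s / Q\<^sup>2 - L2 / Q) * (s / Q\<^sup>2 - L3 / Q) / (s / Q\<^sup>2)) * Pd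
        + Q * (- (Q + 1 / Q) * s\<^sup>2 + (H1 + H2 + H3 + (L1 + L2 + L3)) * s
              + (L1 * L2 * L3 / X + X * (H1 * H2 * H3)) / s) * P)"
    (is "?B * Pu + Q\<^sup>2 * ?D * Pd + Q * ?C * P = m\<^sup>2 * X * (X * ?B' * Pu + Q\<^sup>2 / X * ?D' * Pd + Q * ?C' * P)")
proof -
  \<comment> \<open>\<open>y\<close> and \<open>z\<close> are the values of \<open>x\<close> at which the coefficients of \<open>Pu\<close> and \<open>Pd\<close> agree on both sides.\<close>
  define y where "y = m * X * Q\<^sup>2 * s"
  define z where "z = m * s / Q\<^sup>2"
  have y0: "y \<noteq> 0" and z0: "z \<noteq> 0" using nz by (simp_all add: y_def z_def)
  define R where "R = x + y - (Q * m * X * H1 + Q * m * X * H2 + Q * m * X * H3)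
                       + (Q * m * X * H1) * (Q * m * X * H2) * (Q * m * X * H3) / (x * y)"
  define S where "S = x + z - (m * L1 / Q + m * L2 / Q + m * L3 / Q)
                       + (m * L1 / Q) * (m * L2 / Q) * (m * L3 / Q) / (x * z)"
  have "m\<^sup>2 * X\<^sup>2 * ?B' = (y - Q * m * X * H1) * (y - Q * m * X * H2) * (y - Q * m * X * H3) / y"
  proof -
    have *: "y - Q * m * X * H = m * X * (Q\<^sup>2 * s - Q * H)" for H
      by (simp add: y_def algebra_simps)
    have "y = m * X * (Q\<^sup>2 * s)" by (simp add: y_def)
    moreover have "m * X \<noteq> 0" using nz by simp
    note cubic_quotient_scale [OF this, of "Q\<^sup>2 * s - Q * H1" "Q\<^sup>2 * s - Q * H2" "Q\<^sup>2 * s - Q * H3" "Q\<^sup>2 * s"]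
    ultimately show ?thesis unfolding * by (simp only: power_mult_distrib)
  qed
  with cubic_quotient_diff [OF nz(4) y0, of "Q * m * X * H1" "Q * m * X * H2" "Q * m * X * H3"]
  have B: "?B - m\<^sup>2 * X\<^sup>2 * ?B' = (x - y) * R" by (simp add: R_def)
  have "m\<^sup>2 * ?D' = (z - m * L1 / Q) * (z - m * L2 / Q) * (z - m * L3 / Q) / z"
  proof -
    have *: "z - m * L / Q = m * (s / Q\<^sup>2 - L / Q)" for L
      by (simp add: z_def algebra_simps)
    have "z = m * (s / Q\<^sup>2)" by (simp add: z_def)
    with cubic_quotient_scale [OF nz(2), of "s / Q\<^sup>2 - L1 / Q" "s / Q\<^sup>2 - L2 / Q" "s / Q\<^sup>2 - L3 / Q" "s / Q\<^sup>2"]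
    show ?thesis unfolding * by (simp only:)
  qed
  with cubic_quotient_diff [OF nz(4) z0, of "m * L1 / Q" "m * L2 / Q" "m * L3 / Q"]
  have D: "?D - m\<^sup>2 * ?D' = (x - z) * S" by (simp add: S_def)
  have up': "(x - y) * Pu = (x - m * s) * P" using up by (simp add: y_def)
  have dn': "Q\<^sup>2 * (x - z) * Pd = Q\<^sup>2 * (x - m * X * s) * P"
  proof -
    have "Q\<^sup>2 * (x - z) = Q\<^sup>2 * x - m * s" using nz(1) by (simp add: z_def right_diff_distrib)
    thus ?thesis using dn by simp
  qed
  have "(?B * Pu + Q\<^sup>2 * ?D * Pd + Q * ?C * P)
          - m\<^sup>2 * X * (X * ?B' * Pu + Q\<^sup>2 / X * ?D' * Pd + Q * ?C' * P)
      = (?B - m\<^sup>2 * X\<^sup>2 * ?B') * Pu + Q\<^sup>2 * (?D - m\<^sup>2 * ?D') * Pd + Q * (?C - m\<^sup>2 * X * ?C') * P"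
    using nz(3) by (simp add: ring_distribs power2_eq_square mult_ac)
  also have "\<dots> = R * ((x - y) * Pu) + S * (Q\<^sup>2 * (x - z) * Pd) + Q * (?C - m\<^sup>2 * X * ?C') * P"
    unfolding B D by (simp only: mult_ac)
  also have "\<dots> = ((x - m * s) * R + Q\<^sup>2 * (x - m * X * s) * S + Q * (?C - m\<^sup>2 * X * ?C')) * P"
    unfolding up' dn' by (simp add: ring_distribs mult_ac)
  also have "(x - m * s) * R + Q\<^sup>2 * (x - m * X * s) * S + Q * (?C - m\<^sup>2 * X * ?C') = 0"
    unfolding R_def S_def y_def z_def using nz
    by (simp add: divide_simps) (simp add: algebra_simps power2_eq_square power3_eq_cube)
  finally show ?thesis by simp
qed

section \<open>Summation by parts on a lattice\<close>

text \<open>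
  Multiplying the three-term equation for \<open>\<phi>\<close> by \<open>\<kappa> v\<close> and subtracting it from \<open>\<phi> w\<close>, where \<open>w\<close> is the
  adjoint three-term expression in \<open>v\<close>, leaves the difference of consecutive boundary terms. Near
  the origin the coefficients \<open>b/s\<close> and \<open>d/s\<close> are \<open>O(1/s)\<close> and \<open>\<phi> = o(s)\<close>; near infinity they are
  \<open>O(s\<^sup>2)\<close> and \<open>\<phi> v = o(s\<^sup>-\<^sup>2)\<close>. So the two growth conditions are exactly what makes the boundary
  terms vanish. The ratio \<open>\<rho>\<close> measures the power growth of \<open>v\<close> at infinity, which \<open>\<phi>\<close> must
  compensate.
\<close>

lemma summation_by_parts:
  fixes s \<phi> v c :: "int \<Rightarrow> complex" and b d :: "complex \<Rightarrow> complex" and \<rho> q \<kappa> :: complex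
  assumes s: "\<And>n. s n = q powi n * \<xi>" and nz: "q \<noteq> 0" "\<xi> \<noteq> 0" "\<rho> \<noteq> 0" and q1: "norm q < 1"
    and b0: "(b \<longlongrightarrow> b0) (at 0)" and binf: "((\<lambda>z. b z / z ^ 3) \<longlongrightarrow> b1) at_infinity"
    and d0: "(d \<longlongrightarrow> d0) (at 0)" and dinf: "((\<lambda>z. d z / z ^ 3) \<longlongrightarrow> d1) at_infinity"
    and \<phi>top: "((\<lambda>n. \<phi> n / s n) \<longlongrightarrow> 0) at_top"
    and \<phi>bot: "((\<lambda>n. \<phi> n * s n ^ 2 / \<rho> powi n) \<longlongrightarrow> 0) at_bot"
    and vtop: "(v \<longlongrightarrow> v0) at_top" and vbot: "((\<lambda>n. v n * \<rho> powi n) \<longlongrightarrow> v1) at_bot"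
    and eigen: "\<And>n. b (s n) / s n * \<phi> (n - 1) + d (s n) / s n * \<phi> (n + 1) + c n * \<phi> n = 0"
    and w: "\<And>n. w n = \<kappa> * (b (s (n + 1)) / s (n + 1) * v (n + 1)
                          + d (s (n - 1)) / s (n - 1) * v (n - 1) + c n * v n)"
    and sm: "(\<lambda>n. \<phi> n * w n) summable_on UNIV"
  shows "(\<Sum>\<^sub>\<infinity>n. \<phi> n * w n) = 0"
proof -
  define F where "F n = b (s n) / s n * \<phi> (n - 1) * v n" for n
  define G where "G n = d (s (n - 1)) / s (n - 1) * \<phi> n * v (n - 1)" for n
  have s0: "s n \<noteq> 0" for n using nz by (simp add: s)
  have ss: "s n = q * s (n - 1)" for n
    using nz by (simp add: s power_int_diff)
  have tops: "filterlim (\<lambda>n. n - 1) at_top (at_top :: int filter)"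
    and bots: "filterlim (\<lambda>n. n - 1) at_bot (at_bot :: int filter)"
    using filterlim_int_shift[of "-1"] by simp_all
  have "(\<lambda>n. q ^ n * \<xi>) \<longlonglongrightarrow> 0"
    using tendsto_mult_left_zero [OF LIMSEQ_power_zero [OF q1]] .
  hence "(s \<longlongrightarrow> 0) at_top" by (simp add: filterlim_at_top_int_iff s)
  hence stop: "filterlim s (at 0) at_top"
    using s0 by (simp add: filterlim_at)
  have "(\<lambda>n. q ^ n * inverse \<xi>) \<longlonglongrightarrow> 0"
    using tendsto_mult_left_zero [OF LIMSEQ_power_zero [OF q1]] .
  hence "filterlim (\<lambda>n. q ^ n * inverse \<xi>) (at 0) sequentially"
    using nz by (simp add: filterlim_at)
  from filterlim_compose [OF filterlim_inverse_at_infinity this]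
  have sbot: "filterlim s at_infinity at_bot"
    by (simp add: filterlim_at_bot_int_iff s power_int_minus)
  have "\<phi> n * w n = \<kappa> * (F (n + 1) - G (n + 1)) - \<kappa> * (F n - G n)" for n
  proof -
    have "\<phi> n * w n = \<phi> n * w n - \<kappa> * v n * (b (s n) / s n * \<phi> (n - 1) + d (s n) / s n * \<phi> (n + 1) + c n * \<phi> n)"
      by (simp only: eigen mult_zero_right diff_zero)
    also have "\<dots> = \<kappa> * (F (n + 1) - G (n + 1)) - \<kappa> * (F n - G n)"
      by (simp add: w F_def G_def algebra_simps)
    finally show ?thesis .
  qed
  moreover have "((\<lambda>n. \<kappa> * (F n - G n)) \<longlongrightarrow> 0) at_top"
  proof -
    have "((\<lambda>n. b (s n) * (\<phi> (n - 1) / s (n - 1)) * v n / q) \<longlongrightarrow> b0 * 0 * v0 / q) at_top"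
      by (intro tendsto_intros vtop nz filterlim_compose [OF b0 stop] filterlim_compose [OF \<phi>top tops])
    moreover have "b (s n) * (\<phi> (n - 1) / s (n - 1)) * v n / q = F n" for n
      by (simp add: F_def ss[of n])
    moreover have "((\<lambda>n. d (s (n - 1)) * (\<phi> n / s n) * v (n - 1) * q) \<longlongrightarrow> d0 * 0 * v0 * q) at_top"
      by (intro tendsto_intros filterlim_compose [OF vtop tops] \<phi>top
            filterlim_compose [OF filterlim_compose [OF d0 stop] tops])
    moreover have "d (s (n - 1)) * (\<phi> n / s n) * v (n - 1) * q = G n" for n
      using nz by (simp add: G_def ss[of n])
    ultimately have "(F \<longlongrightarrow> 0) at_top" "(G \<longlongrightarrow> 0) at_top" by simp_all
    from tendsto_mult [OF tendsto_const tendsto_diff [OF this]] show ?thesis by simp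
  qed
  moreover have "((\<lambda>n. \<kappa> * (F n - G n)) \<longlongrightarrow> 0) at_bot"
  proof -
    have \<rho>: "\<rho> powi n = \<rho> * \<rho> powi (n - 1)" for n using nz by (simp add: power_int_diff)
    have \<rho>0: "\<rho> powi n \<noteq> 0" for n using nz by simp
    have "((\<lambda>n. b (s n) / s n ^ 3 * (\<phi> (n - 1) * s (n - 1) ^ 2 / \<rho> powi (n - 1)) * (v n * \<rho> powi n) * (q ^ 2 / \<rho>))
             \<longlongrightarrow> b1 * 0 * v1 * (q ^ 2 / \<rho>)) at_bot"
      by (intro tendsto_mult tendsto_const vbot filterlim_compose [OF binf sbot] filterlim_compose [OF \<phi>bot bots])
    moreover have "b (s n) / s n ^ 3 * (\<phi> (n - 1) * s (n - 1) ^ 2 / \<rho> powi (n - 1)) * (v n * \<rho> powi n) * (q ^ 2 / \<rho>) = F n" for n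
      using s0[of "n - 1"] nz \<rho>0[of "n - 1"] unfolding F_def ss[of n] \<rho>[of n]
      by (simp add: field_simps power2_eq_square power3_eq_cube)
    moreover have "((\<lambda>n. d (s (n - 1)) / s (n - 1) ^ 3 * (\<phi> n * s n ^ 2 / \<rho> powi n) * (v (n - 1) * \<rho> powi (n - 1)) * (\<rho> / q ^ 2))
             \<longlongrightarrow> d1 * 0 * v1 * (\<rho> / q ^ 2)) at_bot"
      by (intro tendsto_mult tendsto_const \<phi>bot filterlim_compose [OF vbot bots]
           filterlim_compose [OF filterlim_compose [OF dinf sbot] bots])
    moreover have "d (s (n - 1)) / s (n - 1) ^ 3 * (\<phi> n * s n ^ 2 / \<rho> powi n) * (v (n - 1) * \<rho> powi (n - 1)) * (\<rho> / q ^ 2) = G n" for n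
      using s0[of "n - 1"] nz \<rho>0[of "n - 1"] unfolding G_def ss[of n] \<rho>[of n]
      by (simp add: field_simps power2_eq_square power3_eq_cube)
    ultimately have "(F \<longlongrightarrow> 0) at_bot" "(G \<longlongrightarrow> 0) at_bot" by simp_all
    from tendsto_mult [OF tendsto_const tendsto_diff [OF this]] show ?thesis by simp
  qed
  ultimately show ?thesis
    using infsum_int_telescope [OF sm, of "\<lambda>n. \<kappa> * (F n - G n)"] by simp
qed

lemma cubic_tendsto_0: "((\<lambda>z. a * (z - c1) * (z - c2) * (z - c3)) \<longlongrightarrow> - (a * c1 * c2 * c3)) (at (0::complex))"
  by (rule tendsto_eq_intros refl)+ simp

lemma cubic_tendsto_infinity:
  "((\<lambda>z. a * (z - c1) * (z - c2) * (z - c3) / z ^ 3) \<longlongrightarrow> a) (at_infinity :: complex filter)"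
proof -
  have "((\<lambda>z. a * (1 - c1 * inverse z) * (1 - c2 * inverse z) * (1 - c3 * inverse z)) \<longlongrightarrow>
          a * (1 - c1 * 0) * (1 - c2 * 0) * (1 - c3 * 0)) (at_infinity :: complex filter)"
    by (intro tendsto_intros tendsto_inverse_0)
  moreover have "\<forall>\<^sub>F z in at_infinity. a * (1 - c1 * inverse z) * (1 - c2 * inverse z) * (1 - c3 * inverse z)
      = a * (z - c1) * (z - c2) * (z - c3) / z ^ 3"
    unfolding eventually_at_infinity
  proof (intro exI[of _ 1] allI impI)
    fix z :: complex
    assume "1 \<le> norm z"
    hence "z \<noteq> 0" by auto
    hence "1 - c * inverse z = (z - c) / z" for c by (simp add: left_diff_distrib divide_inverse)
    thus "a * (1 - c1 * inverse z) * (1 - c2 * inverse z) * (1 - c3 * inverse z)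
      = a * (z - c1) * (z - c2) * (z - c3) / z ^ 3"
      by (simp add: power3_eq_cube)
  qed
  ultimately show ?thesis using tendsto_cong by force
qed

section \<open>Powers along a lattice\<close>

lemma qpow_add: "qpow lq (a + b) = qpow lq a * qpow lq b"
  by (simp add: qpow_def ring_distribs exp_add)

lemma qpow_diff: "qpow lq (a - b) = qpow lq a / qpow lq b"
  by (simp add: qpow_def ring_distribs exp_diff)

lemma qpow_minus: "qpow lq (- a) = inverse (qpow lq a)"
  by (simp add: qpow_def exp_minus)

lemma qpow_nonzero [simp]: "qpow lq a \<noteq> 0"
  by (simp add: qpow_def)

lemma xpow_add: "xpow Lg x (a + b) = xpow Lg x a * xpow Lg x b"
  by (simp add: xpow_def ring_distribs exp_add)

lemma xpow_minus: "xpow Lg x (- a) = inverse (xpow Lg x a)"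
  by (simp add: xpow_def exp_minus)

lemma xpow_nonzero [simp]: "xpow Lg x a \<noteq> 0"
  by (simp add: xpow_def)

lemma xpow_one: "log_branch q lq Lg \<Longrightarrow> x \<noteq> 0 \<Longrightarrow> xpow Lg x 1 = x"
  by (simp add: xpow_def log_branch_def)

lemma log_branch_nonzero: "log_branch q lq Lg \<Longrightarrow> q \<noteq> 0"
  by (auto simp: log_branch_def)

lemma qpow_half: "log_branch q lq Lg \<Longrightarrow> (qpow lq (1/2))\<^sup>2 = q"
  by (simp add: qpow_def log_branch_def flip: exp_double)

lemma xpow_step:
  assumes "log_branch q lq Lg" "x \<noteq> 0"
  shows "xpow Lg (q * x) a = qpow lq a * xpow Lg x a"
  using assms by (simp add: xpow_def qpow_def log_branch_def ring_distribs exp_add)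

lemma xpow_step_inverse:
  assumes "log_branch q lq Lg" "x \<noteq> 0"
  shows "xpow Lg (inverse q * x) a = xpow Lg x a / qpow lq a"
proof -
  have q: "q \<noteq> 0" by (rule log_branch_nonzero [OF assms(1)])
  hence "q * (inverse q * x) = x" by simp
  with xpow_step [OF assms(1), of "inverse q * x" a] q assms(2)
  show ?thesis by (simp add: field_simps)
qed

lemma xpow_lattice:
  assumes "log_branch q lq Lg" "x \<noteq> 0"
  shows "xpow Lg (q powi n * x) a = qpow lq a powi n * xpow Lg x a"
proof -
  have q: "q \<noteq> 0" by (rule log_branch_nonzero [OF assms(1)])
  show ?thesis
  proof (induction n rule: int_induct [where k = 0])
    case base
    show ?case by simp
  next
    case (step1 i)
    have "q powi (i + 1) * x = q * (q powi i * x)" using q by (simp add: power_int_add)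
    thus ?case using xpow_step [OF assms(1), of "q powi i * x" a] q assms(2) step1
      by (simp add: power_int_add mult_ac)
  next
    case (step2 i)
    have "q powi (i - 1) * x = inverse q * (q powi i * x)"
      using q by (simp add: power_int_diff field_simps)
    thus ?case using xpow_step_inverse [OF assms(1), of "q powi i * x" a] q assms(2) step2
      by (simp add: power_int_diff)
  qed
qed

section \<open>The kernel along a lattice\<close>

lemma kernel_P_step:
  assumes "norm q < 1" "x \<noteq> 0" "qpoch_inf (qpow lq \<mu>0 * s / x) q \<noteq> 0"
  shows "(x - qpow lq \<mu> * s) * kernel_P q lq \<mu> \<mu>0 x (q * s)
           = (x - qpow lq \<mu>0 * s) * kernel_P q lq \<mu> \<mu>0 x s"
proof -
  define a b where "a = qpow lq \<mu> * s / x" and "b = qpow lq \<mu>0 * s / x"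
  have A: "qpoch_inf a q = (1 - a) * qpoch_inf (q * a) q"
    and B: "qpoch_inf b q = (1 - b) * qpoch_inf (q * b) q"
    by (rule qpoch_inf_step [OF assms(1)])+
  have "(1 - b) * qpoch_inf (q * b) q \<noteq> 0"
    using assms(3) unfolding B[symmetric] by (simp add: b_def)
  hence "(1 - a) * (qpoch_inf (q * a) q / qpoch_inf (q * b) q)
           = (1 - b) * (qpoch_inf a q / qpoch_inf b q)"
    unfolding A B by simp
  moreover have "q * a = qpow lq \<mu> * (q * s) / x" "q * b = qpow lq \<mu>0 * (q * s) / x"
    by (simp_all add: a_def b_def)
  ultimately have "(1 - a) * kernel_P q lq \<mu> \<mu>0 x (q * s) = (1 - b) * kernel_P q lq \<mu> \<mu>0 x s"
    by (simp only: kernel_P_def a_def b_def)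
  hence "x * (1 - a) * kernel_P q lq \<mu> \<mu>0 x (q * s) = x * (1 - b) * kernel_P q lq \<mu> \<mu>0 x s"
    by simp
  moreover have "x * (1 - a) = x - qpow lq \<mu> * s" "x * (1 - b) = x - qpow lq \<mu>0 * s"
    using assms(2) by (simp_all add: a_def b_def right_diff_distrib)
  ultimately show ?thesis by simp
qed

lemma kernel_P_at_zero:
  assumes "norm q < 1"
  shows "((\<lambda>n. kernel_P q lq \<mu> \<mu>0 x (q powi n * \<xi>)) \<longlongrightarrow> 1) at_top"
proof -
  have "(\<lambda>n. qpoch_inf (q ^ n * (qpow lq \<mu> * \<xi> / x)) q / qpoch_inf (q ^ n * (qpow lq \<mu>0 * \<xi> / x)) q)
          \<longlonglongrightarrow> 1 / 1"
    by (intro tendsto_intros qpoch_inf_tendsto_1 assms) simp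
  thus ?thesis by (simp add: filterlim_at_top_int_iff kernel_P_def mult_ac)
qed

text \<open>
  In other words the kernel is asymptotically a multiple of \<open>s\<^bsup>\<mu>\<^sub>0 - \<mu>\<^esup>\<close> as \<open>s\<close> tends to infinity
  along the lattice.
\<close>

lemma kernel_P_at_infinity:
  assumes "norm q < 1" "q \<noteq> 0" "x \<noteq> 0" "\<xi> \<noteq> 0"
    and nz: "\<And>n. qpoch_inf (qpow lq \<mu>0 * (q powi n * \<xi>) / x) q \<noteq> 0"
  shows "\<exists>c. ((\<lambda>n. kernel_P q lq \<mu> \<mu>0 x (q powi n * \<xi>) * qpow lq (\<mu> - \<mu>0) powi n) \<longlongrightarrow> c) at_bot"
proof -
  define a b where "a = qpow lq \<mu> * \<xi> / x" and "b = qpow lq \<mu>0 * \<xi> / x"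
  have ab0: "a \<noteq> 0" "b \<noteq> 0" using assms by (simp_all add: a_def b_def)
  have ab: "qpow lq c * (q powi (- int n) * \<xi>) / x = qpow lq c * \<xi> / x / q ^ n" for n c
    using assms by (simp add: power_int_minus field_simps)
  have "qpow lq (\<mu> - \<mu>0) powi (- int n) = (b / a) ^ n" for n
    using assms by (simp add: power_int_minus a_def b_def qpow_diff power_divide)
  moreover have "qpoch_inf (b / q ^ n) q \<noteq> 0" for n
    using nz[of "- int n"] unfolding ab b_def .
  ultimately show ?thesis
    unfolding filterlim_at_bot_int_iff kernel_P_def ab a_def[symmetric] b_def[symmetric]
    using qpoch_inf_ratio_asymp [OF assms(1,2) ab0] by auto
qed

section \<open>The integral transform of an eigenfunction\<close>

text \<open>
  The constants of the operator appear only through \<open>q\<^bsup>1/2\<^esup>\<close>, \<open>q\<^sup>\<alpha>\<close>, the products \<open>q\<^bsup>h\<^sub>i\<^esup> t\<^sub>i\<close> and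
  \<open>q\<^bsup>l\<^sub>i\<^esup> t\<^sub>i\<close>, and the coefficient of \<open>1/x\<close>. In this form eigenvalue equations become identities
  between rational functions.
\<close>

lemma A3_expand:
  fixes lq :: complex and t h l :: "nat \<Rightarrow> complex"
  defines "Q \<equiv> qpow lq (1/2)" and "H \<equiv> \<lambda>i. qpow lq (h i) * t i" and "L \<equiv> \<lambda>i. qpow lq (l i) * t i"
  shows "A3 q lq t h l \<alpha> \<beta> f x =
     (x - Q * H 1) * (x - Q * H 2) * (x - Q * H 3) / x * f (inverse q * x)
   + (qpow lq \<alpha>)\<^sup>2 * Q\<^sup>2 * ((x - L 1 / Q) * (x - L 2 / Q) * (x - L 3 / Q) / x) * f (q * x)
   + qpow lq \<alpha> * (Q * (- (Q + 1 / Q) * x\<^sup>2 + (H 1 + H 2 + H 3 + (L 1 + L 2 + L 3)) * x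
       + (qpow lq ((l 1 + l 2 + l 3 + h 1 + h 2 + h 3 + \<beta>) / 2)
          + qpow lq ((l 1 + l 2 + l 3 + h 1 + h 2 + h 3 - \<beta>) / 2)) * (t 1 * t 2 * t 3) / x)) * f x"
proof -
  have p3: "prod F {1..3} = F 1 * F 2 * F 3" for F :: "nat \<Rightarrow> complex"
    by (simp add: eval_nat_numeral prod.cl_ivl_Suc)
  have s3: "sum F {1..3} = F 1 + F 2 + F 3" for F :: "nat \<Rightarrow> complex"
    by (simp add: eval_nat_numeral sum.cl_ivl_Suc)
  have e1: "qpow lq (c + 1/2) = Q * qpow lq c" "qpow lq (c - 1/2) = qpow lq c / Q" for c
    by (simp_all add: Q_def qpow_add qpow_diff)
  have e2: "qpow lq (2 * \<alpha> + 1) = (qpow lq \<alpha>)\<^sup>2 * Q\<^sup>2"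
    by (simp add: Q_def power2_eq_square flip: qpow_add)
  have e3: "qpow lq (- 1/2) = 1 / Q"
    using qpow_minus[of lq "1/2"] by (simp add: Q_def inverse_eq_divide)
  have e4: "qpow lq (a / 2) * (qpow lq (\<beta> / 2) + qpow lq (- \<beta> / 2))
      = qpow lq ((a + \<beta>) / 2) + qpow lq ((a - \<beta>) / 2)" for a
  proof -
    have "(a + \<beta>) / 2 = a / 2 + \<beta> / 2" "(a - \<beta>) / 2 = a / 2 + - \<beta> / 2"
      by (simp_all add: field_simps)
    thus ?thesis by (simp only: qpow_add ring_distribs)
  qed
  have e5: "(qpow lq (h i) + qpow lq (l i)) * t i = H i + L i" for i
    by (simp add: H_def L_def ring_distribs)
  have e6: "qpow lq (h i) * t i = H i" "qpow lq (l i) / Q * t i = L i / Q" for i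
    by (simp_all add: H_def L_def)
  show ?thesis
    unfolding A3_def p3 s3 e1 e2 e3 e4 e5 mult.assoc[of Q]
    unfolding e6 Q_def[symmetric] by (simp only: divide_inverse mult_ac add_ac)
qed

text \<open>
  By the limits of the kernel at the two ends of the lattice, the summand is \<open>o(q\<^sup>n)\<close> as
  \<open>n \<rightarrow> \<infinity>\<close> and \<open>o(q\<^bsup>-2n\<^esup>)\<close> as \<open>n \<rightarrow> -\<infinity>\<close>. The lattice of \<open>s\<close> is not tied to \<open>x\<close>, so the
  result applies equally to \<open>x/q\<close> and \<open>q x\<close>.
\<close>

lemma summable_with_kernel:
  fixes \<phi> :: "int \<Rightarrow> complex"
  assumes q: "norm q < 1" "q \<noteq> 0" and nz: "x \<noteq> 0" "\<xi> \<noteq> 0"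
    and nonvanish: "\<And>n. qpoch_inf (qpow lq \<mu>0 * (q powi n * \<xi>) / x) q \<noteq> 0"
    and top: "((\<lambda>n. \<phi> n / (q powi n * \<xi>)) \<longlongrightarrow> 0) at_top"
    and bot: "((\<lambda>n. \<phi> n * (q powi n * \<xi>)\<^sup>2 / qpow lq (\<mu> - \<mu>0) powi n) \<longlongrightarrow> 0) at_bot"
  shows "(\<lambda>n. \<phi> n * kernel_P q lq \<mu> \<mu>0 x (q powi n * \<xi>)) summable_on UNIV"
proof (rule summable_on_int_geometric)
  let ?v = "\<lambda>n. kernel_P q lq \<mu> \<mu>0 x (q powi n * \<xi>)"
  show "norm q < 1" "q \<noteq> 0" "norm (q\<^sup>2) < 1" "q\<^sup>2 \<noteq> 0"
    using q by (simp_all add: norm_power power_less_one_iff)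
  have "((\<lambda>n. \<phi> n / (q powi n * \<xi>) * ?v n * \<xi>) \<longlongrightarrow> 0 * 1 * \<xi>) at_top"
    by (intro tendsto_intros top kernel_P_at_zero q)
  thus "((\<lambda>n. \<phi> n * ?v n / q powi n) \<longlongrightarrow> 0) at_top"
    using nz by (simp add: field_simps)
  obtain c where c: "((\<lambda>n. ?v n * qpow lq (\<mu> - \<mu>0) powi n) \<longlongrightarrow> c) at_bot"
    using kernel_P_at_infinity [OF q nz nonvanish] by blast
  have "((\<lambda>n. \<phi> n * (q powi n * \<xi>)\<^sup>2 / qpow lq (\<mu> - \<mu>0) powi n
             * (?v n * qpow lq (\<mu> - \<mu>0) powi n) / \<xi>\<^sup>2) \<longlongrightarrow> 0 * c / \<xi>\<^sup>2) at_bot"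
    using nz by (intro tendsto_intros bot c) auto
  moreover have "\<phi> n * (q powi n * \<xi>)\<^sup>2 / qpow lq (\<mu> - \<mu>0) powi n
             * (?v n * qpow lq (\<mu> - \<mu>0) powi n) / \<xi>\<^sup>2 = \<phi> n * ?v n * (q\<^sup>2) powi n" for n
    using nz by (simp add: power2_eq_square power_int_mult_distrib)
  ultimately show "((\<lambda>n. \<phi> n * ?v n * (q\<^sup>2) powi n) \<longlongrightarrow> 0) at_bot"
    by simp
qed

text \<open>
  This is the statement for a single point \<open>x\<close> and a fixed base point \<open>\<xi>\<close>. Here
  \<open>1 - \<chi> - \<alpha>'\<close> is the exponent \<open>(h'\<^sub>1 + h'\<^sub>2 + h'\<^sub>3 - l'\<^sub>1 - l'\<^sub>2 - l'\<^sub>3 - 2\<alpha>' + \<beta>' + 2)/2\<close>, and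
  \<open>\<phi>(s) = s f(s)\<close> absorbs the measure \<open>d\<^sub>qs\<close> and the power of \<open>s\<close> into the eigenfunction. The eigenvalue
  equation for \<open>hh\<close> then becomes a three-term equation for \<open>\<phi>\<close> with coefficients \<open>b/s\<close>, \<open>d/s\<close> and
  \<open>C' - \<epsilon>\<close>, where \<open>\<epsilon>\<close> is the eigenvalue \<open>E'\<close> freed of \<open>q\<^bsup>\<alpha>'\<^esup>\<close>; the kernel identity shows that the
  operator in \<open>x\<close> yields the adjoint expression \<open>w\<close>.
\<close>

lemma A3_integral_transform:
  fixes q lq :: complex and Lg :: "complex \<Rightarrow> complex" and t h' l' h l :: "nat \<Rightarrow> complex"
    and \<alpha> \<beta> \<alpha>' \<beta>' \<mu>0 chi E' x \<xi> :: complex and hh f J :: "complex \<Rightarrow> complex"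
  defines "f \<equiv> \<lambda>s. xpow Lg s (\<alpha>' + chi - 1) * hh s"
    and "\<mu> \<equiv> \<mu>0 + 1 + chi"
  assumes q: "norm q < 1" and branch: "log_branch q lq Lg"
    and nz: "x \<noteq> 0" "\<xi> \<noteq> 0"
    and nonvanish: "\<And>n. qpoch_inf (qpow lq \<mu>0 * (q powi n * \<xi>) / x) q \<noteq> 0"
    and eigen: "\<And>n. A3 q lq t h' l' \<alpha>' \<beta>' hh (q powi n * \<xi>) = E' * hh (q powi n * \<xi>)"
    and top: "((\<lambda>n. hh (q powi n * \<xi>) / xpow Lg (q powi n * \<xi>) (1 - chi - \<alpha>')) \<longlongrightarrow> 0) at_top"
    and bot: "((\<lambda>n. hh (q powi n * \<xi>) / xpow Lg (q powi n * \<xi>) (- \<alpha>' - 1)) \<longlongrightarrow> 0) at_bot"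
    and chi: "chi = (l' 1 + l' 2 + l' 3 - h' 1 - h' 2 - h' 3 - \<beta>') / 2"
    and \<beta>: "\<beta> = - \<beta>' - chi"
    and l: "\<And>i. i \<in> {1..3} \<Longrightarrow> l i = l' i + \<mu>0"
    and h: "\<And>i. i \<in> {1..3} \<Longrightarrow> h i = h' i + \<mu>0 + chi"
    and J: "\<And>y. J y = jackson_integral q \<xi> (\<lambda>s. f s * kernel_P q lq \<mu> \<mu>0 y s)"
  shows "jackson_converges q \<xi> (\<lambda>s. f s * kernel_P q lq \<mu> \<mu>0 x s)"
    and "A3 q lq t h l \<alpha> \<beta> (\<lambda>y. xpow Lg y (- \<alpha>) * J y) x
           = qpow lq (2 * \<mu>0 + \<alpha> - \<alpha>' + chi) * E' * (xpow Lg x (- \<alpha>) * J x)"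
proof -
  have q0: "q \<noteq> 0" by (rule log_branch_nonzero [OF branch])
  define s where "s n = q powi n * \<xi>" for n
  define \<phi> where "\<phi> n = s n * f (s n)" for n
  define v where "v n = kernel_P q lq \<mu> \<mu>0 x (s n)" for n
  have s0: "s n \<noteq> 0" for n using nz q0 by (simp add: s_def)
  have s_up: "s (n + 1) = q * s n" and s_dn: "s (n - 1) = inverse q * s n" for n
    using q0 by (simp_all add: s_def power_int_add power_int_diff field_simps)

  \<comment> \<open>The two growth conditions, restated for \<open>\<phi>\<close>.\<close>
  have "\<phi> n / s n = hh (s n) / xpow Lg (s n) (1 - chi - \<alpha>')" for n
  proof -
    have "xpow Lg (s n) (\<alpha>' + chi - 1) = inverse (xpow Lg (s n) (1 - chi - \<alpha>'))"
      by (simp add: algebra_simps flip: xpow_minus)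
    thus ?thesis using s0[of n] by (simp add: \<phi>_def f_def divide_inverse)
  qed
  hence \<phi>top: "((\<lambda>n. \<phi> n / s n) \<longlongrightarrow> 0) at_top"
    using top by (simp add: s_def)
  have "\<phi> n * (s n)\<^sup>2 / qpow lq (\<mu> - \<mu>0) powi n
          = hh (s n) / xpow Lg (s n) (- \<alpha>' - 1) * xpow Lg \<xi> (1 + chi)" for n
  proof -
    have "xpow Lg (s n) (1 + chi) = qpow lq (1 + chi) powi n * xpow Lg \<xi> (1 + chi)"
      unfolding s_def by (rule xpow_lattice [OF branch nz(2)])
    hence "inverse (qpow lq (1 + chi) powi n) = xpow Lg \<xi> (1 + chi) * xpow Lg (s n) (- 1 - chi)"
      using xpow_minus[of Lg "s n" "1 + chi"] by (simp add: field_simps)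
    moreover have "xpow Lg (s n) (\<alpha>' + chi - 1) * xpow Lg (s n) 1 * xpow Lg (s n) 1 * xpow Lg (s n) 1
        * xpow Lg (s n) (- 1 - chi) = inverse (xpow Lg (s n) (- \<alpha>' - 1))"
      by (simp add: algebra_simps flip: xpow_add xpow_minus)
    moreover have "\<mu> - \<mu>0 = 1 + chi" by (simp add: \<mu>_def)
    ultimately show ?thesis
      unfolding xpow_one [OF branch s0]
      by (simp add: \<phi>_def f_def divide_inverse power2_eq_square mult_ac)
  qed
  hence \<phi>bot: "((\<lambda>n. \<phi> n * (s n)\<^sup>2 / qpow lq (\<mu> - \<mu>0) powi n) \<longlongrightarrow> 0) at_bot"
    using tendsto_mult_left_zero [OF bot, of "xpow Lg \<xi> (1 + chi)"] by (simp add: s_def)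

  have nonvanish': "qpoch_inf (qpow lq \<mu>0 * (q powi n * \<xi>) / (q powi k * x)) q \<noteq> 0" for n k
  proof -
    have "qpow lq \<mu>0 * (q powi n * \<xi>) / (q powi k * x) = qpow lq \<mu>0 * (q powi (n - k) * \<xi>) / x"
      using q0 by (simp add: power_int_diff)
    thus ?thesis using nonvanish by simp
  qed
  have ker: "kernel_P q lq \<mu> \<mu>0 (q powi k * x) (s n) = v (n - k)" for n k
    using q0 by (simp add: v_def kernel_P_def s_def power_int_diff)
  have sm: "(\<lambda>n. \<phi> n * v (n - k)) summable_on UNIV" for k
    using summable_with_kernel [OF q q0 _ nz(2) nonvanish' \<phi>top[unfolded s_def] \<phi>bot[unfolded s_def], of k]
      nz(1) q0 ker[of k] by (simp flip: s_def)
  have terms: "s n * (f (s n) * kernel_P q lq \<mu> \<mu>0 (q powi k * x) (s n)) = \<phi> n * v (n - k)" for n k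
    by (simp add: \<phi>_def ker)
  show "jackson_converges q \<xi> (\<lambda>s. f s * kernel_P q lq \<mu> \<mu>0 x s)"
    using sm[of 0] terms[of _ 0] by (simp add: jackson_converges_def flip: s_def)
  have Jk: "J (q powi k * x) = (1 - q) * (\<Sum>\<^sub>\<infinity>n. \<phi> n * v (n - k))" for k
    using terms[of _ k] by (simp add: J jackson_integral_def flip: s_def)

  define Q where "Q = qpow lq (1/2)"
  define m where "m = qpow lq \<mu>0"
  define X where "X = qpow lq chi"
  define a where "a = qpow lq \<alpha>"
  define a' where "a' = qpow lq \<alpha>'"
  define H where "H i = qpow lq (h' i) * t i" for i
  define L where "L i = qpow lq (l' i) * t i" for i
  have nz': "Q \<noteq> 0" "m \<noteq> 0" "X \<noteq> 0" "a \<noteq> 0" "a' \<noteq> 0"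
    by (simp_all add: Q_def m_def X_def a_def a'_def)
  have QQ: "Q\<^sup>2 = q" unfolding Q_def by (rule qpow_half [OF branch])

  define b where "b z = X * (z - Q * H 1) * (z - Q * H 2) * (z - Q * H 3)" for z
  define d where "d z = Q\<^sup>2 / X * (z - L 1 / Q) * (z - L 2 / Q) * (z - L 3 / Q)" for z
  define C' where "C' z = Q * (- (Q + 1 / Q) * z\<^sup>2 + (H 1 + H 2 + H 3 + (L 1 + L 2 + L 3)) * z
              + (L 1 * L 2 * L 3 / X + X * (H 1 * H 2 * H 3)) / z)" for z
  define B where "B = (x - Q * m * X * H 1) * (x - Q * m * X * H 2) * (x - Q * m * X * H 3) / x"
  define D where "D = (x - m * L 1 / Q) * (x - m * L 2 / Q) * (x - m * L 3 / Q) / x"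
  define C where "C = Q * (- (Q + 1 / Q) * x\<^sup>2 + (m * X * (H 1 + H 2 + H 3) + m * (L 1 + L 2 + L 3)) * x
              + m ^ 3 * (X\<^sup>2 * (H 1 * H 2 * H 3) + X * (L 1 * L 2 * L 3)) / x)"
  define \<epsilon> where "\<epsilon> = E' / a'"
  define w where "w n = B * v (n + 1) + Q\<^sup>2 * D * v (n - 1) + (C - m\<^sup>2 * X * \<epsilon>) * v n" for n

  \<comment> \<open>The definition of \<open>\<chi>\<close> removes the half-sums from the exponents in the coefficient of \<open>1/z\<close>, for
    both operators: what is left are the products of the \<open>H\<^sub>i\<close> and of the \<open>L\<^sub>i\<close> with integral powers
    of \<open>m\<close> and \<open>X\<close>.\<close>
  have A3': "A3 q lq t h' l' \<alpha>' \<beta>' hh z =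
       b z / X / z * hh (inverse q * z) + a'\<^sup>2 * (X * d z / z) * hh (q * z) + a' * C' z * hh z" for z
  proof -
    have "(l' 1 + l' 2 + l' 3 + h' 1 + h' 2 + h' 3 + \<beta>') / 2 = l' 1 + l' 2 + l' 3 - chi"
         "(l' 1 + l' 2 + l' 3 + h' 1 + h' 2 + h' 3 - \<beta>') / 2 = h' 1 + h' 2 + h' 3 + chi"
      by (simp_all add: chi field_simps)
    hence const: "(qpow lq ((l' 1 + l' 2 + l' 3 + h' 1 + h' 2 + h' 3 + \<beta>') / 2)
       + qpow lq ((l' 1 + l' 2 + l' 3 + h' 1 + h' 2 + h' 3 - \<beta>') / 2)) * (t 1 * t 2 * t 3)
       = L 1 * L 2 * L 3 / X + X * (H 1 * H 2 * H 3)"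
      by (simp only: L_def H_def X_def qpow_add qpow_diff) (simp add: algebra_simps)
    have bX: "b z / X / z = (z - Q * H 1) * (z - Q * H 2) * (z - Q * H 3) / z"
      and dX: "X * d z / z = Q\<^sup>2 * ((z - L 1 / Q) * (z - L 2 / Q) * (z - L 3 / Q) / z)"
      using nz' by (simp_all add: b_def d_def)
    show ?thesis
      unfolding A3_expand const bX dX C'_def Q_def[symmetric] H_def[symmetric] L_def[symmetric] a'_def[symmetric]
      by (simp only: mult.assoc)
  qed
  have A3g: "A3 q lq t h l \<alpha> \<beta> F x = B * F (inverse q * x) + a\<^sup>2 * (Q\<^sup>2 * D) * F (q * x) + a * C * F x" for F
  proof -
    have hl: "qpow lq (h i) * t i = m * X * H i" "qpow lq (l i) * t i = m * L i"
      if "i \<in> {1..3}" for i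
      using h[OF that] l[OF that] by (simp_all add: m_def X_def H_def L_def qpow_add)
    have idx: "h 1 = h' 1 + \<mu>0 + chi" "h 2 = h' 2 + \<mu>0 + chi" "h 3 = h' 3 + \<mu>0 + chi"
         "l 1 = l' 1 + \<mu>0" "l 2 = l' 2 + \<mu>0" "l 3 = l' 3 + \<mu>0"
      using h l by simp_all
    have "(l 1 + l 2 + l 3 + h 1 + h 2 + h 3 + \<beta>) / 2 = h' 1 + h' 2 + h' 3 + (\<mu>0 + \<mu>0 + \<mu>0) + (chi + chi)"
         "(l 1 + l 2 + l 3 + h 1 + h 2 + h 3 - \<beta>) / 2 = l' 1 + l' 2 + l' 3 + (\<mu>0 + \<mu>0 + \<mu>0) + chi"
      unfolding idx \<beta> chi by (simp_all add: field_simps)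
    hence const: "(qpow lq ((l 1 + l 2 + l 3 + h 1 + h 2 + h 3 + \<beta>) / 2)
       + qpow lq ((l 1 + l 2 + l 3 + h 1 + h 2 + h 3 - \<beta>) / 2)) * (t 1 * t 2 * t 3)
       = m ^ 3 * (X\<^sup>2 * (H 1 * H 2 * H 3) + X * (L 1 * L 2 * L 3))"
      by (simp only: L_def H_def X_def m_def qpow_add power2_eq_square power3_eq_cube
            distrib_left distrib_right mult_ac)
    have C: "C = Q * (- (Q + 1 / Q) * x\<^sup>2 + (m * X * H 1 + m * X * H 2 + m * X * H 3
        + (m * L 1 + m * L 2 + m * L 3)) * x
        + m ^ 3 * (X\<^sup>2 * (H 1 * H 2 * H 3) + X * (L 1 * L 2 * L 3)) / x)"
      unfolding C_def by (simp only: distrib_left[of "m * X"] distrib_left[of m])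
    have "(1::nat) \<in> {1..3}" "(2::nat) \<in> {1..3}" "(3::nat) \<in> {1..3}" by simp_all
    note hl = this[THEN hl(1)] this[THEN hl(2)]
    show ?thesis
      unfolding A3_expand const hl B_def D_def C Q_def[symmetric] a_def[symmetric]
      by (simp only: mult.assoc)
  qed

  have eigen': "b (s n) / s n * \<phi> (n - 1) + d (s n) / s n * \<phi> (n + 1) + (C' (s n) - \<epsilon>) * \<phi> n = 0" for n
  proof -
    define r where "r = xpow Lg (s n) (\<alpha>' + chi)"
    have r: "\<phi> k = xpow Lg (s k) (\<alpha>' + chi) * hh (s k)" for k
    proof -
      have "xpow Lg (s k) (\<alpha>' + chi) = xpow Lg (s k) (\<alpha>' + chi - 1) * xpow Lg (s k) 1"
        by (simp flip: xpow_add)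
      thus ?thesis by (simp add: \<phi>_def f_def xpow_one [OF branch s0])
    qed
    have ax: "qpow lq (\<alpha>' + chi) = a' * X" by (simp add: a'_def X_def qpow_add)
    have 0: "\<phi> n = r * hh (s n)" by (simp add: r r_def)
    have 1: "\<phi> (n - 1) = r / (a' * X) * hh (inverse q * s n)"
      unfolding r s_dn xpow_step_inverse [OF branch s0] ax r_def ..
    have 2: "\<phi> (n + 1) = a' * X * r * hh (q * s n)"
      unfolding r s_up xpow_step [OF branch s0] ax r_def ..
    have "b (s n) / s n * \<phi> (n - 1) + d (s n) / s n * \<phi> (n + 1) + (C' (s n) - \<epsilon>) * \<phi> n
        = r / a' * (A3 q lq t h' l' \<alpha>' \<beta>' hh (s n) - E' * hh (s n))"
      unfolding 0 1 2 A3' \<epsilon>_def using nz' by (simp add: field_simps power2_eq_square)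
    also have "\<dots> = 0" using eigen[of n] by (simp add: s_def)
    finally show ?thesis .
  qed

  have w: "w n = m\<^sup>2 * X * (b (s (n + 1)) / s (n + 1) * v (n + 1)
                          + d (s (n - 1)) / s (n - 1) * v (n - 1) + (C' (s n) - \<epsilon>) * v n)" for n
  proof -
    have \<mu>: "qpow lq \<mu> = m * X * Q\<^sup>2"
      unfolding QQ using branch
      by (simp add: \<mu>_def m_def X_def qpow_add) (simp add: qpow_def log_branch_def)
    have step: "(x - m * X * Q\<^sup>2 * s k) * v (k + 1) = (x - m * s k) * v k" for k
      using kernel_P_step [OF q nz(1), of lq \<mu>0 "s k" \<mu>] nonvanish[of k]
      by (simp add: \<mu> v_def s_up flip: m_def s_def)
    have up: "(x - m * X * Q\<^sup>2 * s n) * v (n + 1) = (x - m * s n) * v n"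
      by (rule step)
    have "q * s (n - 1) = s n" using q0 by (simp add: s_dn)
    with step[of "n - 1"] have "(x - m * X * s n) * v n = (x - m * s (n - 1)) * v (n - 1)"
      by (simp add: QQ mult.assoc)
    hence "q * ((x - m * X * s n) * v n) = (q * x - m * (q * s (n - 1))) * v (n - 1)"
      by (simp only:) (simp add: algebra_simps)
    hence dn: "(Q\<^sup>2 * x - m * s n) * v (n - 1) = Q\<^sup>2 * (x - m * X * s n) * v n"
      by (simp only: \<open>q * s (n - 1) = s n\<close> QQ mult.assoc)
    have s': "s (n + 1) = Q\<^sup>2 * s n" "s (n - 1) = s n / Q\<^sup>2"
      unfolding QQ s_up s_dn by (simp_all add: field_simps)
    have bz: "b z / z = X * ((z - Q * H 1) * (z - Q * H 2) * (z - Q * H 3) / z)"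
      and dz: "d z / z = Q\<^sup>2 / X * ((z - L 1 / Q) * (z - L 2 / Q) * (z - L 3 / Q) / z)" for z
      by (simp_all add: b_def d_def)
    have "B * v (n + 1) + Q\<^sup>2 * D * v (n - 1) + C * v n
            = m\<^sup>2 * X * (b (s (n + 1)) / s (n + 1) * v (n + 1)
                          + d (s (n - 1)) / s (n - 1) * v (n - 1) + C' (s n) * v n)"
      unfolding s' bz dz B_def D_def C_def C'_def
      by (rule kernel_identity [OF nz'(1,2,3) nz(1) s0 up dn])
    moreover have "U + (C - k * \<epsilon>) * y = k * (V + (c - \<epsilon>) * y)" if "U + C * y = k * (V + c * y)"
      for U V k c y using that by (simp add: algebra_simps)
    ultimately show ?thesis unfolding w_def by blast
  qed

  have lin: "(\<Sum>\<^sub>\<infinity>n. \<phi> n * w n) = B * (\<Sum>\<^sub>\<infinity>n. \<phi> n * v (n + 1))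
      + Q\<^sup>2 * D * (\<Sum>\<^sub>\<infinity>n. \<phi> n * v (n - 1)) + (C - m\<^sup>2 * X * \<epsilon>) * (\<Sum>\<^sub>\<infinity>n. \<phi> n * v n)"
    and smw: "(\<lambda>n. \<phi> n * w n) summable_on UNIV"
  proof -
    have sms: "(\<lambda>n. \<phi> n * v (n + 1)) summable_on UNIV" "(\<lambda>n. \<phi> n * v (n - 1)) summable_on UNIV"
         "(\<lambda>n. \<phi> n * v n) summable_on UNIV"
      using sm[of "-1"] sm[of 1] sm[of 0] by simp_all
    have "((\<lambda>n. B * (\<phi> n * v (n + 1)) + Q\<^sup>2 * D * (\<phi> n * v (n - 1)) + (C - m\<^sup>2 * X * \<epsilon>) * (\<phi> n * v n))
       has_sum (B * (\<Sum>\<^sub>\<infinity>n. \<phi> n * v (n + 1))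
      + Q\<^sup>2 * D * (\<Sum>\<^sub>\<infinity>n. \<phi> n * v (n - 1)) + (C - m\<^sup>2 * X * \<epsilon>) * (\<Sum>\<^sub>\<infinity>n. \<phi> n * v n))) UNIV"
      by (intro has_sum_add has_sum_cmult_right has_sum_infsum sms)
    moreover have "B * (\<phi> n * v (n + 1)) + Q\<^sup>2 * D * (\<phi> n * v (n - 1)) + (C - m\<^sup>2 * X * \<epsilon>) * (\<phi> n * v n)
        = \<phi> n * w n" for n by (simp add: w_def algebra_simps)
    ultimately have hs: "((\<lambda>n. \<phi> n * w n) has_sum (B * (\<Sum>\<^sub>\<infinity>n. \<phi> n * v (n + 1))
      + Q\<^sup>2 * D * (\<Sum>\<^sub>\<infinity>n. \<phi> n * v (n - 1)) + (C - m\<^sup>2 * X * \<epsilon>) * (\<Sum>\<^sub>\<infinity>n. \<phi> n * v n))) UNIV"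
      by simp
    from infsumI [OF hs]
    show "(\<Sum>\<^sub>\<infinity>n. \<phi> n * w n) = B * (\<Sum>\<^sub>\<infinity>n. \<phi> n * v (n + 1))
      + Q\<^sup>2 * D * (\<Sum>\<^sub>\<infinity>n. \<phi> n * v (n - 1)) + (C - m\<^sup>2 * X * \<epsilon>) * (\<Sum>\<^sub>\<infinity>n. \<phi> n * v n)" .
    show "(\<lambda>n. \<phi> n * w n) summable_on UNIV" using hs unfolding summable_on_def by blast
  qed
  obtain v1 where vbot: "((\<lambda>n. v n * qpow lq (\<mu> - \<mu>0) powi n) \<longlongrightarrow> v1) at_bot"
    using kernel_P_at_infinity [OF q q0 nz nonvanish] unfolding v_def s_def by blast
  have vtop: "(v \<longlongrightarrow> 1) at_top"
    using kernel_P_at_zero [OF q] unfolding v_def s_def .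
  have b0: "(b \<longlongrightarrow> - (X * (Q * H 1) * (Q * H 2) * (Q * H 3))) (at 0)"
    and binf: "((\<lambda>z. b z / z ^ 3) \<longlongrightarrow> X) at_infinity"
    unfolding b_def[abs_def] by (rule cubic_tendsto_0 cubic_tendsto_infinity)+
  have d0: "(d \<longlongrightarrow> - (Q\<^sup>2 / X * (L 1 / Q) * (L 2 / Q) * (L 3 / Q))) (at 0)"
    and dinf: "((\<lambda>z. d z / z ^ 3) \<longlongrightarrow> Q\<^sup>2 / X) at_infinity"
    unfolding d_def[abs_def] by (rule cubic_tendsto_0 cubic_tendsto_infinity)+
  have "(\<Sum>\<^sub>\<infinity>n. \<phi> n * w n) = 0"
    by (rule summation_by_parts [where s = s and b = b and d = d and c = "\<lambda>n. C' (s n) - \<epsilon>",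
          OF s_def q0 nz(2) qpow_nonzero q b0 binf d0 dinf \<phi>top \<phi>bot vtop vbot eigen' w smw])
  hence main: "B * (\<Sum>\<^sub>\<infinity>n. \<phi> n * v (n + 1)) + Q\<^sup>2 * D * (\<Sum>\<^sub>\<infinity>n. \<phi> n * v (n - 1))
        + C * (\<Sum>\<^sub>\<infinity>n. \<phi> n * v n) = m\<^sup>2 * X * \<epsilon> * (\<Sum>\<^sub>\<infinity>n. \<phi> n * v n)"
    unfolding lin by (simp add: algebra_simps)
  have J3: "J (inverse q * x) = (1 - q) * (\<Sum>\<^sub>\<infinity>n. \<phi> n * v (n + 1))"
      "J (q * x) = (1 - q) * (\<Sum>\<^sub>\<infinity>n. \<phi> n * v (n - 1))" "J x = (1 - q) * (\<Sum>\<^sub>\<infinity>n. \<phi> n * v n)"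
    using Jk[of "-1"] Jk[of 1] Jk[of 0] by (simp_all add: power_int_minus)
  have x3: "xpow Lg (inverse q * x) (- \<alpha>) = a * xpow Lg x (- \<alpha>)"
       "xpow Lg (q * x) (- \<alpha>) = xpow Lg x (- \<alpha>) / a"
    unfolding xpow_step_inverse [OF branch nz(1)] xpow_step [OF branch nz(1)] qpow_minus a_def
    by (simp_all add: divide_inverse mult.commute)
  have E: "qpow lq (2 * \<mu>0 + \<alpha> - \<alpha>' + chi) * E' = a * (m\<^sup>2 * X * \<epsilon>)"
  proof -
    have "2 * \<mu>0 + \<alpha> - \<alpha>' + chi = \<mu>0 + \<mu>0 + \<alpha> + chi - \<alpha>'" by simp
    thus ?thesis
      by (simp only: qpow_add qpow_diff) (simp add: \<epsilon>_def m_def X_def a_def a'_def power2_eq_square)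
  qed
  have "A3 q lq t h l \<alpha> \<beta> (\<lambda>y. xpow Lg y (- \<alpha>) * J y) x
      = a * xpow Lg x (- \<alpha>) * (1 - q) * (B * (\<Sum>\<^sub>\<infinity>n. \<phi> n * v (n + 1))
          + Q\<^sup>2 * D * (\<Sum>\<^sub>\<infinity>n. \<phi> n * v (n - 1)) + C * (\<Sum>\<^sub>\<infinity>n. \<phi> n * v n))"
    unfolding A3g x3 J3 using nz' by (simp add: field_simps power2_eq_square)
  also have "\<dots> = qpow lq (2 * \<mu>0 + \<alpha> - \<alpha>' + chi) * E' * (xpow Lg x (- \<alpha>) * J x)"
    unfolding main E J3 by (simp add: mult_ac)
  finally show "A3 q lq t h l \<alpha> \<beta> (\<lambda>y. xpow Lg y (- \<alpha>) * J y) x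
           = qpow lq (2 * \<mu>0 + \<alpha> - \<alpha>' + chi) * E' * (xpow Lg x (- \<alpha>) * J x)" .
qed

theorem theorem4p3:
  fixes q lq :: complex and Lg :: "complex \<Rightarrow> complex"
    and t h' l' h l :: "nat \<Rightarrow> complex"
    and \<alpha> \<beta> \<alpha>' \<beta>' \<mu> \<mu>0 chi E E' :: complex
    and X :: "complex set" and \<xi> hh g :: "complex \<Rightarrow> complex"
  assumes q: "0 < norm q" "norm q < 1"
    and branch: "log_branch q lq Lg"
    and X: "0 \<notin> X" "\<And>x. x \<in> X \<Longrightarrow> q * x \<in> X \<and> inverse q * x \<in> X"
    and \<xi>: "(\<exists>c. c \<noteq> 0 \<and> (\<forall>x\<in>X. \<xi> x = c)) \<or> (\<exists>A. A \<noteq> 0 \<and> (\<forall>x\<in>X. \<xi> x = A * x))"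
    and defined: "\<And>x n. x \<in> X \<Longrightarrow> qpoch_inf (qpow lq \<mu>0 * (q powi n * \<xi> x) / x) q \<noteq> 0"
    and eigen: "\<And>x n. x \<in> X \<Longrightarrow>
          A3 q lq t h' l' \<alpha>' \<beta>' hh (q powi n * \<xi> x) = E' * hh (q powi n * \<xi> x)"
    and lim_zero: "\<And>x. x \<in> X \<Longrightarrow>
          ((\<lambda>L::int. hh (q powi L * \<xi> x) /
              xpow Lg (q powi L * \<xi> x)
                ((h' 1 + h' 2 + h' 3 - l' 1 - l' 2 - l' 3 - 2 * \<alpha>' + \<beta>' + 2) / 2))
            \<longlongrightarrow> 0) at_top"
    and lim_infinity: "\<And>x. x \<in> X \<Longrightarrow>
          ((\<lambda>K::int. hh (q powi K * \<xi> x) / xpow Lg (q powi K * \<xi> x) (- \<alpha>' - 1))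
            \<longlongrightarrow> 0) at_bot"
    and chi_eq: "chi = (l' 1 + l' 2 + l' 3 - h' 1 - h' 2 - h' 3 - \<beta>') / 2"
    and E: "E = qpow lq (2 * \<mu>0 + \<alpha> - \<alpha>' + chi) * E'"
    and \<mu>: "\<mu> = \<mu>0 + 1 + chi"
    and \<beta>: "\<beta> = - \<beta>' - chi"
    and l: "\<And>i. i \<in> {1..3} \<Longrightarrow> l i = l' i + \<mu>0"
    and h: "\<And>i. i \<in> {1..3} \<Longrightarrow> h i = h' i + \<mu>0 + chi"
    and g: "\<And>x. x \<in> X \<Longrightarrow> g x = xpow Lg x (- \<alpha>) *
          jackson_integral q (\<xi> x) (\<lambda>s.
            xpow Lg s (- (h' 1 + h' 2 + h' 3 - l' 1 - l' 2 - l' 3 - 2 * \<alpha>' + \<beta>' + 2) / 2)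
              * hh s * kernel_P q lq \<mu> \<mu>0 x s)"
  shows "\<forall>x\<in>X.
      jackson_converges q (\<xi> x) (\<lambda>s.
        xpow Lg s (- (h' 1 + h' 2 + h' 3 - l' 1 - l' 2 - l' 3 - 2 * \<alpha>' + \<beta>' + 2) / 2)
          * hh s * kernel_P q lq \<mu> \<mu>0 x s)
    \<and> A3 q lq t h l \<alpha> \<beta> g x = E * g x"
proof
  fix x assume x: "x \<in> X"
  have q0: "q \<noteq> 0" using q by auto
  have x0: "x \<noteq> 0" using x X(1) by auto
  have \<xi>0: "\<xi> x \<noteq> 0" using \<xi> x x0 by auto
  have exponent: "(h' 1 + h' 2 + h' 3 - l' 1 - l' 2 - l' 3 - 2 * \<alpha>' + \<beta>' + 2) / 2 = 1 - chi - \<alpha>'"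
    "- (h' 1 + h' 2 + h' 3 - l' 1 - l' 2 - l' 3 - 2 * \<alpha>' + \<beta>' + 2) / 2 = \<alpha>' + chi - 1"
    by (simp_all add: chi_eq field_simps)
  define f where "f s = xpow Lg s (\<alpha>' + chi - 1) * hh s" for s
  define J where "J y = jackson_integral q (\<xi> x) (\<lambda>s. f s * kernel_P q lq \<mu> \<mu>0 y s)" for y
  have gJ: "g y = xpow Lg y (- \<alpha>) * J y" if "y \<in> {x, q * x, inverse q * x}" for y
  proof -
    have y: "y \<in> X" using that x X(2) by auto
    \<comment> \<open>In both cases the base points of \<open>x\<close>, \<open>q x\<close> and \<open>x/q\<close> lie on one lattice.\<close>
    obtain k :: int where "\<xi> y = q powi k * \<xi> x"
    proof (cases "\<exists>c. c \<noteq> 0 \<and> (\<forall>x\<in>X. \<xi> x = c)")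
      case True
      thus ?thesis using that[of 0] x y by auto
    next
      case False
      then obtain A where A: "\<And>x. x \<in> X \<Longrightarrow> \<xi> x = A * x" using \<xi> by auto
      from \<open>y \<in> {x, q * x, inverse q * x}\<close> show ?thesis
        using that[of 0] that[of 1] that[of "-1"] A[OF x] A[OF y] by (auto simp: power_int_minus)
    qed
    thus ?thesis unfolding g[OF y] exponent J_def f_def[symmetric] by (simp add: jackson_shift[OF q0])
  qed
  note transform = A3_integral_transform [OF q(2) branch x0 \<xi>0 defined[OF x] eigen[OF x]
      lim_zero[OF x, unfolded exponent] lim_infinity[OF x] chi_eq \<beta> l h J_def[unfolded f_def \<mu>]]
  have "A3 q lq t h l \<alpha> \<beta> g x = A3 q lq t h l \<alpha> \<beta> (\<lambda>y. xpow Lg y (- \<alpha>) * J y) x"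
    by (simp add: A3_def gJ)
  also have "\<dots> = E * g x"
    using transform(2) by (simp add: E gJ)
  finally show "jackson_converges q (\<xi> x) (\<lambda>s.
        xpow Lg s (- (h' 1 + h' 2 + h' 3 - l' 1 - l' 2 - l' 3 - 2 * \<alpha>' + \<beta>' + 2) / 2)
          * hh s * kernel_P q lq \<mu> \<mu>0 x s)
    \<and> A3 q lq t h l \<alpha> \<beta> g x = E * g x"
    using transform(1) unfolding exponent \<mu> by blast
qed

end
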